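(* The approximation factor of Double Proposal for the resident-side master list model satisfies $$\max_{I\in\mathcal I_{\text{R-ML}}}\frac{\mathrm{OPT}(I)}{\mathrm{ALG}(I)}=1,$$ where $\mathcal I_{\text{R-ML}}$ is the family of instances of HRT-MSLQ in which all residents have the same preference list (possibly with ties). That is, on every such instance Double Proposal outputs a stable matching of maximum score.
   Context: Problem. An instance $I$ of HRT-MSLQ consists of a set $R=\{r_1,\dots,r_n\}$ of residents ($n\ge 1$) and a set $H=\{h_1,\dots,h_m\}$ of hospitals (agents are indexed). Each resident $r$ has a complete preference list over $H$ that may contain ties (a total preorder $\succeq_r$; $\succ_r$ is strict preference, $=_r$ indifference), and each hospital $h$ likewise has a complete preference list over $R$ that may contain ties. Each hospital $h$ has an integer lower quota $\ell(h)$ and upper quota $u(h)$ with $0\le \ell(h)\le u(h)\le n$, $u(h)\ge 1$. Standing assumption: $|R|<\sum_{h\in H}u(h)$. An assignment is a set $M\subseteq R\times H$; $M(r)=\{h:(r,h)\in M\}$, $M(h)=\{r:(r,h)\in M\}$. $M$ is a matching if $|M(r)|\le 1$ for all $r$ and $|M(h)|\le u(h)$ for all $h$; then $M(r)$ also denotes the unique hospital of a matched resident $r$. A pair $(r,h)$ blocks a matching $M$ if (i) $r$ is unmatched in $M$ or $h\succ_r M(r)$, and (ii) $|M(h)|<u(h)$ or $h$ strictly prefers $r$ to at least one resident in $M(h)$. $M$ is stable if no pair blocks it. The score of $h$ in $M$ is $s_M(h)=\min\{1,|M(h)|/\ell(h)\}$, with $s_M(h)=1$ if $\ell(h)=0$;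 the score of $M$ is $s(M)=\sum_{h\in H}s_M(h)$. $\mathrm{OPT}(I)$ is the maximum of $s(M)$ over stable matchings $M$ of $I$. $\mathrm{ALG}(I)$ is the score of the output of Double Proposal on $I$. Algorithm Double Proposal (deterministic). Regard a hospital not in any tie of a resident's list as a tie of length one. Start with $M:=\emptyset$. While some resident is unmatched in $M$: let $r$ be the unmatched resident with smallest index and $T$ the top tie of $r$'s current list. If $T$ contains a hospital to which $r$ has not yet proposed, let $h$ be such a hospital with minimum $\ell(h)$; otherwise let $h$ be a hospital in $T$ with minimum $\ell(h)$ (in both cases break remaining ties by smallest hospital index). Resident $r$ proposes to $h$, and then: (1) if $|M(h)|<\ell(h)$, set $M:=M\cup\{(r,h)\}$; (2) else, if some resident in $M(h)\cup\{r\}$ has not been rejected by $h$ so far, let $r'$ be the one among such residents with the largest index (possibly $r'=r$) and set $M:=(M\cup\{(r,h)\})\setminus\{(r',h)\}$; (3) else, if $|M(h)|<u(h)$, set $M:=M\cup\{(r,h)\}$; (4) else, let $r'$ be a resident in $M(h)\cup\{r\}$ that is worst for $h$ (the one with largest index if there are several; possibly $r'=r$), set $M:=(M\cup\{(r,h)\})\setminus\{(r',h)\}$, and delete $h$ from the list of $r'$. In (2) and (4), $r'$ is said to be rejected by $h$. When no resident is unmatched, output $M$. (The output is a stable matching.) *)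

theory Defs
  imports Complex_Main "HOL-Library.While_Combinator"
begin

section \<open>Instances\<close>

text \<open>
  Agents are represented by their indices. A preference list with ties is a total preorder,
  where \<open>(x, y) \<in> res_pref I r\<close> reads ``\<open>r\<close> finds \<open>x\<close> at least as good as \<open>y\<close>''.
\<close>

record hrt_instance =
  num_res :: nat
  num_hosp :: nat
  res_pref :: "nat \<Rightarrow> (nat \<times> nat) set"
  hosp_pref :: "nat \<Rightarrow> (nat \<times> nat) set"
  lower :: "nat \<Rightarrow> nat"
  upper :: "nat \<Rightarrow> nat"

definition residents :: "hrt_instance \<Rightarrow> nat set" where
  "residents I = {1..num_res I}"

definition hospitals :: "hrt_instance \<Rightarrow> nat set" where
  "hospitals I = {1..num_hosp I}"

definition total_preorder_on :: "'a set \<Rightarrow> ('a \<times> 'a) set \<Rightarrow> bool" where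
  "total_preorder_on A r \<longleftrightarrow> preorder_on A r \<and> total_on A r"

definition strictly_prefers :: "('a \<times> 'a) set \<Rightarrow> 'a \<Rightarrow> 'a \<Rightarrow> bool" where
  "strictly_prefers p x y \<longleftrightarrow> (x, y) \<in> p \<and> (y, x) \<notin> p"

definition hrt_mslq :: "hrt_instance \<Rightarrow> bool" where
  "hrt_mslq I \<longleftrightarrow>
     num_res I \<ge> 1 \<and>
     (\<forall>r\<in>residents I. total_preorder_on (hospitals I) (res_pref I r)) \<and>
     (\<forall>h\<in>hospitals I. total_preorder_on (residents I) (hosp_pref I h)) \<and>
     (\<forall>h\<in>hospitals I. lower I h \<le> upper I h \<and> upper I h \<le> num_res I \<and> 1 \<le> upper I h) \<and>
     card (residents I) < (\<Sum>h\<in>hospitals I. upper I h)"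

definition R_ML :: "hrt_instance set" where
  "R_ML = {I. hrt_mslq I \<and>
     (\<forall>r\<in>residents I. \<forall>r'\<in>residents I. res_pref I r = res_pref I r')}"


section \<open>Stable matchings and scores\<close>

type_synonym assignment = "(nat \<times> nat) set"

definition hosp_of :: "assignment \<Rightarrow> nat \<Rightarrow> nat set" where
  "hosp_of M r = {h. (r, h) \<in> M}"

definition res_of :: "assignment \<Rightarrow> nat \<Rightarrow> nat set" where
  "res_of M h = {r. (r, h) \<in> M}"

definition matching :: "hrt_instance \<Rightarrow> assignment \<Rightarrow> bool" where
  "matching I M \<longleftrightarrow>
     M \<subseteq> residents I \<times> hospitals I \<and>
     (\<forall>r\<in>residents I. card (hosp_of M r) \<le> 1) \<and>
     (\<forall>h\<in>hospitals I. card (res_of M h) \<le> upper I h)"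

definition blocks :: "hrt_instance \<Rightarrow> assignment \<Rightarrow> nat \<Rightarrow> nat \<Rightarrow> bool" where
  "blocks I M r h \<longleftrightarrow>
     (hosp_of M r = {} \<or> (\<exists>h'\<in>hosp_of M r. strictly_prefers (res_pref I r) h h')) \<and>
     (card (res_of M h) < upper I h \<or>
      (\<exists>r'\<in>res_of M h. strictly_prefers (hosp_pref I h) r r'))"

definition stable_matching :: "hrt_instance \<Rightarrow> assignment \<Rightarrow> bool" where
  "stable_matching I M \<longleftrightarrow>
     matching I M \<and> \<not> (\<exists>r\<in>residents I. \<exists>h\<in>hospitals I. blocks I M r h)"

definition hosp_score :: "hrt_instance \<Rightarrow> assignment \<Rightarrow> nat \<Rightarrow> real" where
  "hosp_score I M h =
     (if lower I h = 0 then 1 else min 1 (real (card (res_of M h)) / real (lower I h)))"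

definition score :: "hrt_instance \<Rightarrow> assignment \<Rightarrow> real" where
  "score I M = (\<Sum>h\<in>hospitals I. hosp_score I M h)"

definition OPT :: "hrt_instance \<Rightarrow> real" where
  "OPT I = Max (score I ` {M. stable_matching I M})"


section \<open>Double Proposal\<close>

text \<open>
  Besides the current assignment, a state records the proposals made so far, the rejections
  issued so far, and the deletions of hospitals from residents' lists; in all four components
  the pair \<open>(r, h)\<close> consists of a resident and a hospital.
\<close>

record dp_state =
  assigned :: assignment
  proposed :: "(nat \<times> nat) set"
  rejected :: "(nat \<times> nat) set"
  deleted :: "(nat \<times> nat) set"

definition dp_init :: dp_state where
  "dp_init = \<lparr>assigned = {}, proposed = {}, rejected = {}, deleted = {}\<rparr>"

definition unmatched :: "hrt_instance \<Rightarrow> dp_state \<Rightarrow> nat set" where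
  "unmatched I s = {r \<in> residents I. hosp_of (assigned s) r = {}}"

definition current_list :: "hrt_instance \<Rightarrow> dp_state \<Rightarrow> nat \<Rightarrow> nat set" where
  "current_list I s r = {h \<in> hospitals I. (r, h) \<notin> deleted s}"

definition top_tie :: "hrt_instance \<Rightarrow> dp_state \<Rightarrow> nat \<Rightarrow> nat set" where
  "top_tie I s r =
     {h \<in> current_list I s r. \<forall>h'\<in>current_list I s r. (h, h') \<in> res_pref I r}"

text \<open>
  \<open>Min {}\<close> is unspecified, but a list never becomes empty: a hospital is deleted from a list
  only when it is full, and the upper quotas sum to more than the number of residents.
\<close>

definition min_lower :: "hrt_instance \<Rightarrow> nat set \<Rightarrow> nat" where
  "min_lower I C = Min {h \<in> C. \<forall>h'\<in>C. lower I h \<le> lower I h'}"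

definition target :: "hrt_instance \<Rightarrow> dp_state \<Rightarrow> nat \<Rightarrow> nat" where
  "target I s r =
     (let T = top_tie I s r; N = {h \<in> T. (r, h) \<notin> proposed s}
      in min_lower I (if N \<noteq> {} then N else T))"

definition worst :: "hrt_instance \<Rightarrow> nat \<Rightarrow> nat set \<Rightarrow> nat" where
  "worst I h A = Max {q \<in> A. \<forall>q'\<in>A. (q', q) \<in> hosp_pref I h}"

definition dp_propose :: "hrt_instance \<Rightarrow> nat \<Rightarrow> nat \<Rightarrow> dp_state \<Rightarrow> dp_state" where
  "dp_propose I r h s =
     (let M = assigned s;
          A = insert r (res_of M h);
          F = {q \<in> A. (q, h) \<notin> rejected s};
          s' = s\<lparr>proposed := insert (r, h) (proposed s)\<rparr>
      in if card (res_of M h) < lower I h then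
           s'\<lparr>assigned := insert (r, h) M\<rparr>
         else if F \<noteq> {} then
           (let r' = Max F
            in s'\<lparr>assigned := insert (r, h) M - {(r', h)},
                  rejected := insert (r', h) (rejected s)\<rparr>)
         else if card (res_of M h) < upper I h then
           s'\<lparr>assigned := insert (r, h) M\<rparr>
         else
           (let r' = worst I h A
            in s'\<lparr>assigned := insert (r, h) M - {(r', h)},
                  rejected := insert (r', h) (rejected s),
                  deleted := insert (r', h) (deleted s)\<rparr>))"

definition dp_step :: "hrt_instance \<Rightarrow> dp_state \<Rightarrow> dp_state" where
  "dp_step I s = (let r = Min (unmatched I s) in dp_propose I r (target I s r) s)"

text \<open>The result is \<open>None\<close> precisely if the loop does not terminate.\<close>

definition double_proposal :: "hrt_instance \<Rightarrow> assignment option" where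
  "double_proposal I =
     map_option assigned (while_option (\<lambda>s. unmatched I s \<noteq> {}) (dp_step I) dp_init)"

definition ALG :: "hrt_instance \<Rightarrow> real" where
  "ALG I = score I (the (double_proposal I))"


section \<open>Maximum of a set of reals\<close>

definition is_maximum :: "real \<Rightarrow> real set \<Rightarrow> bool" where
  "is_maximum x S \<longleftrightarrow> x \<in> S \<and> (\<forall>y\<in>S. y \<le> x)"

end

theory Submission
  imports Defs
begin

text \<open>
  Once a hospital has rejected anybody it keeps at least its lower quota. A resident reaches a
  hospital of a tie only after being rejected by all hospitals of that tie with smaller lower
  quota, and proposes to it a second time only after being rejected by the whole tie. Hence within
  a tie the output fills lower quotas greedily in increasing order and exceeds one of them only
  when all are met. Under a master list all stable matchings agree except within a single tie,
  and there the greedy distribution maximises the score.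
\<close>

section \<open>Total preorders\<close>

lemma total_preorder_on_refl: "total_preorder_on X p \<Longrightarrow> x \<in> X \<Longrightarrow> (x, x) \<in> p"
  by (auto simp: total_preorder_on_def preorder_on_def refl_on_def)

lemma total_preorder_on_trans: "total_preorder_on X p \<Longrightarrow> (x, y) \<in> p \<Longrightarrow> (y, z) \<in> p \<Longrightarrow> (x, z) \<in> p"
  by (auto simp: total_preorder_on_def preorder_on_def dest: transD)

lemma total_preorder_on_total:
  "total_preorder_on X p \<Longrightarrow> x \<in> X \<Longrightarrow> y \<in> X \<Longrightarrow> (x, y) \<in> p \<or> (y, x) \<in> p"
  by (cases "x = y") (auto simp: total_preorder_on_def preorder_on_def refl_on_def total_on_def)

lemma total_preorder_on_converse: "total_preorder_on X p \<Longrightarrow> total_preorder_on X (p\<inverse>)"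
  by (auto simp: total_preorder_on_def preorder_on_def refl_on_def total_on_def)

lemma total_preorder_on_best:
  assumes "total_preorder_on X p" "finite A" "A \<noteq> {}" "A \<subseteq> X"
  shows "\<exists>a\<in>A. \<forall>b\<in>A. (a, b) \<in> p"
  using assms(2-4)
proof (induction A rule: finite_ne_induct)
  case (singleton x)
  then show ?case using total_preorder_on_refl[OF assms(1)] by auto
next
  case (insert x A)
  then obtain a where a: "a \<in> A" "\<forall>b\<in>A. (a, b) \<in> p" by auto
  have "(x, x) \<in> p"
    using total_preorder_on_refl[OF assms(1)] insert.prems by auto
  moreover have "(x, a) \<in> p \<or> (a, x) \<in> p"
    using total_preorder_on_total[OF assms(1)] a(1) insert.prems by auto
  ultimately show ?case
    using a total_preorder_on_trans[OF assms(1), of x a] by blast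
qed

lemma total_preorder_on_worst:
  assumes "total_preorder_on X p" "finite A" "A \<noteq> {}" "A \<subseteq> X"
  shows "\<exists>a\<in>A. \<forall>b\<in>A. (b, a) \<in> p"
  using total_preorder_on_best[OF total_preorder_on_converse[OF assms(1)] assms(2-4)] by simp


section \<open>Assignments\<close>

lemma card_assignment_res_of:
  assumes "finite H" "finite R" "M \<subseteq> R \<times> H"
  shows "card M = (\<Sum>h\<in>H. card (res_of M h))"
proof -
  have "M = prod.swap ` (SIGMA h:H. res_of M h)"
    using assms by (force simp: res_of_def)
  then have "card M = card (SIGMA h:H. res_of M h)"
    by (metis card_image inj_swap)
  moreover have "finite (res_of M h)" for h
    by (rule finite_subset[OF _ assms(2)]) (use assms(3) in \<open>auto simp: res_of_def\<close>)
  ultimately show ?thesis using assms(1) by (simp add: card_SigmaI)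
qed

text \<open>Counting by residents. Against \<open>card_assignment_res_of\<close>, which counts the
  same pairs by hospitals, it compares the number of residents with the hospital loads.\<close>

lemma card_functional_assignment:
  assumes "finite R" "M \<subseteq> R \<times> H" "\<And>r h h'. (r, h) \<in> M \<Longrightarrow> (r, h') \<in> M \<Longrightarrow> h = h'"
  shows "card M = card {r \<in> R. hosp_of M r \<noteq> {}}"
proof -
  have "inj_on fst M" using assms(3) by (auto simp: inj_on_def)
  moreover have "fst ` M = {r \<in> R. hosp_of M r \<noteq> {}}"
    using assms(2) by (force simp: hosp_of_def)
  ultimately show ?thesis by (metis card_image)
qed

lemma res_of_insert:
  "res_of (insert (r, h) M) h' = (if h' = h then insert r (res_of M h) else res_of M h')"
  by (auto simp: res_of_def)

lemma res_of_swap: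
  "res_of (insert (r, h) M - {(w, h)}) h' =
     (if h' = h then insert r (res_of M h) - {w} else res_of M h')"
  by (auto simp: res_of_def)

lemma mem_res_of: "r \<in> res_of M h \<longleftrightarrow> (r, h) \<in> M"
  by (simp add: res_of_def)

lemma mem_hosp_of: "h \<in> hosp_of M r \<longleftrightarrow> (r, h) \<in> M"
  by (simp add: hosp_of_def)

text \<open>The function \<open>min 1 (x / l)\<close> is concave on x \<ge> 0, and
  \<open>1 / L\<close> is the slope of a supporting line at \<open>y\<close>. The two conditional
  hypotheses describe the admissible slopes: at least \<open>1 / l\<close> at 0, exactly
  \<open>1 / l\<close> in between, at most \<open>1 / l\<close> at the kink
  \<open>y = l\<close>.\<close>

lemma score_diff_le:
  fixes x y l L :: real
  assumes "0 \<le> x" "0 < l" "0 < L" "y \<le> l" "y < l \<Longrightarrow> L \<le> l" "0 < y \<Longrightarrow> l \<le> L" "0 \<le> y"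
  shows "min 1 (x / l) \<le> min 1 (y / l) + (x - y) / L"
proof (cases "y < l")
  case True
  have "x / l - y / l \<le> (x - y) / L"
  proof (cases "y = 0")
    case True
    then show ?thesis using assms by (simp add: frac_le)
  next
    case False
    then have "L = l" using assms True by force
    then show ?thesis by (simp add: diff_divide_distrib)
  qed
  moreover have "min 1 (y / l) = y / l" using True assms by simp
  ultimately show ?thesis using min.cobounded2[of 1 "x / l"] by linarith
next
  case False
  then have y: "y = l" "l \<le> L" using assms by auto
  show ?thesis
  proof (cases "x \<le> l")
    case True
    have "(l - x) / L \<le> (l - x) / l" using True y assms by (simp add: frac_le)
    then have "x / l \<le> 1 + (x - l) / L"
      using assms by (simp add: diff_divide_distrib)
    then show ?thesis using y assms by (simp add: min_def)
  next
    case False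
    then show ?thesis using y assms by (simp add: min_def)
  qed
qed


section \<open>Consequences of the instance axioms\<close>

locale hrt =
  fixes I :: hrt_instance
  assumes inst: "hrt_mslq I"
begin

lemma finite_residents [simp]: "finite (residents I)"
  by (simp add: residents_def)

lemma finite_hospitals [simp]: "finite (hospitals I)"
  by (simp add: hospitals_def)

lemma res_pref: "r \<in> residents I \<Longrightarrow> total_preorder_on (hospitals I) (res_pref I r)"
  using inst by (simp add: hrt_mslq_def)

lemma hosp_pref: "h \<in> hospitals I \<Longrightarrow> total_preorder_on (residents I) (hosp_pref I h)"
  using inst by (simp add: hrt_mslq_def)

lemma lower_le_upper: "h \<in> hospitals I \<Longrightarrow> lower I h \<le> upper I h"
  using inst by (simp add: hrt_mslq_def)

lemma card_residents_less: "card (residents I) < (\<Sum>h\<in>hospitals I. upper I h)"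
  using inst by (simp add: hrt_mslq_def)

lemma residents_nonempty: "residents I \<noteq> {}"
  using inst by (simp add: hrt_mslq_def residents_def)

lemma finite_assignment: "M \<subseteq> residents I \<times> hospitals I \<Longrightarrow> finite M"
  by (rule finite_subset) auto

lemma finite_res_of:
  assumes "M \<subseteq> residents I \<times> hospitals I"
  shows "finite (res_of M h)"
  by (rule finite_subset[OF _ finite_residents]) (use assms in \<open>auto simp: res_of_def\<close>)

text \<open>If all hospitals were full, the pairs in \<open>M\<close> would outnumber the residents,
  by the standing assumption on upper quotas.\<close>

lemma exists_not_full:
  assumes "M \<subseteq> residents I \<times> hospitals I"
    and "\<And>r h h'. (r, h) \<in> M \<Longrightarrow> (r, h') \<in> M \<Longrightarrow> h = h'"
  shows "\<exists>h\<in>hospitals I. card (res_of M h) < upper I h"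
proof (rule ccontr)
  assume "\<not> ?thesis"
  then have "(\<Sum>h\<in>hospitals I. upper I h) \<le> card M"
    using card_assignment_res_of[OF finite_hospitals finite_residents assms(1)]
    by (simp add: sum_mono linorder_not_less)
  also have "\<dots> \<le> card (residents I)"
    using card_functional_assignment[OF finite_residents assms(1)] assms(2)
    by (simp add: card_mono)
  finally show False using card_residents_less by simp
qed

end


section \<open>Invariant of Double Proposal\<close>

text \<open>The clauses on \<open>deleted\<close> and \<open>better_deleted\<close> serve stability.
  \<open>rejected_lower\<close>, \<open>above_lower_rejected\<close> and \<open>tie_lower\<close>
  express greedy filling within a tie. The alternative \<open>(r, h) \<in> rejected s\<close> in
  \<open>tie_lower\<close> covers a repeated proposal, which occurs only after every hospital of the
  tie has rejected \<open>r\<close>.\<close>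

locale dp_invariant = hrt I for I +
  fixes s :: dp_state
  assumes proposed_subset: "proposed s \<subseteq> residents I \<times> hospitals I"
    and proposed_eq: "proposed s = assigned s \<union> rejected s"
    and deleted_rejected: "(r, h) \<in> deleted s \<Longrightarrow> (r, h) \<in> rejected s"
    and assigned_not_deleted: "(r, h) \<in> assigned s \<Longrightarrow> (r, h) \<notin> deleted s"
    and assigned_unique: "(r, h) \<in> assigned s \<Longrightarrow> (r, h') \<in> assigned s \<Longrightarrow> h = h'"
    and card_le_upper: "h \<in> hospitals I \<Longrightarrow> card (res_of (assigned s) h) \<le> upper I h"
    and rejected_lower: "(r, h) \<in> rejected s \<Longrightarrow> lower I h \<le> card (res_of (assigned s) h)"
    and deleted_full: "(r, h) \<in> deleted s \<Longrightarrow> card (res_of (assigned s) h) = upper I h"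
    and deleted_all_rejected: "(r, h) \<in> deleted s \<Longrightarrow> (q, h) \<in> assigned s \<Longrightarrow> (q, h) \<in> rejected s"
    and deleted_worse: "(r, h) \<in> deleted s \<Longrightarrow> (q, h) \<in> assigned s \<Longrightarrow> (q, r) \<in> hosp_pref I h"
    and above_lower_rejected: "lower I h < card (res_of (assigned s) h) \<Longrightarrow>
          (q, h) \<in> assigned s \<Longrightarrow> (q, h) \<in> rejected s"
    and better_deleted: "(r, h) \<in> assigned s \<Longrightarrow> h' \<in> hospitals I \<Longrightarrow>
          strictly_prefers (res_pref I r) h' h \<Longrightarrow> (r, h') \<in> deleted s"
    and tie_lower: "(r, h) \<in> assigned s \<Longrightarrow> h' \<in> hospitals I \<Longrightarrow>
          (h, h') \<in> res_pref I r \<Longrightarrow> (h', h) \<in> res_pref I r \<Longrightarrow>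
          lower I h' < lower I h \<or> (r, h) \<in> rejected s \<Longrightarrow>
          lower I h' \<le> card (res_of (assigned s) h')"

lemma (in hrt) dp_invariant_init: "dp_invariant I dp_init"
  by unfold_locales (auto simp: dp_init_def res_of_def)

context dp_invariant
begin

lemma assigned_subset: "assigned s \<subseteq> residents I \<times> hospitals I"
  using proposed_subset proposed_eq by blast

lemma rejected_subset: "rejected s \<subseteq> residents I \<times> hospitals I"
  using proposed_subset proposed_eq by blast

lemma deleted_subset: "deleted s \<subseteq> residents I \<times> hospitals I"
  using rejected_subset deleted_rejected by auto

lemma finite_res_of_assigned [simp]: "finite (res_of (assigned s) h)"
  by (rule finite_res_of[OF assigned_subset])

end

section \<open>A single proposal\<close>

definition progress :: "dp_state \<Rightarrow> nat" where
  "progress t = card (assigned t) + card (rejected t) + card (deleted t)"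

text \<open>The two target assumptions are \<open>better_deleted\<close> and
  \<open>tie_lower\<close> for the pair \<open>(r, h)\<close> before it is assigned, so that it
  satisfies these clauses once accepted.\<close>

locale dp_proposal = dp_invariant I s for I s +
  fixes r h :: nat
  assumes r: "r \<in> residents I" and h: "h \<in> hospitals I"
    and unassigned: "(r, h') \<notin> assigned s"
    and not_deleted: "(r, h) \<notin> deleted s"
    and target_better_deleted: "h' \<in> hospitals I \<Longrightarrow> strictly_prefers (res_pref I r) h' h \<Longrightarrow>
          (r, h') \<in> deleted s"
    and target_tie_lower: "h' \<in> hospitals I \<Longrightarrow>
          (h, h') \<in> res_pref I r \<Longrightarrow> (h', h) \<in> res_pref I r \<Longrightarrow>
          lower I h' < lower I h \<or> (r, h) \<in> rejected s \<Longrightarrow>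
          lower I h' \<le> card (res_of (assigned s) h')"
begin

lemma r_notin_res_of [simp]: "r \<notin> res_of (assigned s) h'"
  using unassigned by (simp add: res_of_def)

lemma card_res_of_insert:
  "card (res_of (insert (r, h) (assigned s)) h') =
     card (res_of (assigned s) h') + (if h' = h then 1 else 0)"
  by (simp add: res_of_insert)

text \<open>This includes \<open>w = r\<close>, where the newcomer itself is turned away.\<close>

lemma card_res_of_swap:
  assumes "w \<in> insert r (res_of (assigned s) h)"
  shows "card (res_of (insert (r, h) (assigned s) - {(w, h)}) h') = card (res_of (assigned s) h')"
  using assms by (auto simp: res_of_swap card_Diff_singleton)

text \<open>Covers rules (1) and (3). The second hypothesis protects
  \<open>above_lower_rejected\<close>: either the load does not exceed the lower quota afterwards,
  or everybody involved has already been rejected.\<close>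

lemma dp_invariant_accept:
  assumes "card (res_of (assigned s) h) < upper I h"
    and "card (res_of (assigned s) h) < lower I h \<or>
         (\<forall>q\<in>insert r (res_of (assigned s) h). (q, h) \<in> rejected s)"
  shows "dp_invariant I (s\<lparr>assigned := insert (r, h) (assigned s),
           proposed := insert (r, h) (proposed s)\<rparr>)"
proof -
  \<comment> \<open>A hospital with room has never been deleted from a list, so the clauses on
    \<open>deleted\<close> are vacuous at \<open>h\<close>.\<close>
  have not_deleted_h: "(q, h) \<notin> deleted s" for q
    using deleted_full assms(1) by force
  show ?thesis
  proof (unfold_locales, goal_cases)
    case 1 show ?case using proposed_subset r h by auto
  next
    case 2 show ?case using proposed_eq by auto
  next
    case (3 r h) then show ?case using deleted_rejected by auto
  next
    case (4 r h) then show ?case using assigned_not_deleted not_deleted by auto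
  next
    case (5 r h h') then show ?case using assigned_unique unassigned by auto
  next
    case (6 h) then show ?case using card_le_upper assms(1) by (auto simp: card_res_of_insert)
  next
    case (7 r h) then show ?case using rejected_lower by (auto simp: card_res_of_insert le_SucI)
  next
    case (8 r h) then show ?case using deleted_full not_deleted_h by (auto simp: card_res_of_insert)
  next
    case (9 r h q) then show ?case using deleted_all_rejected not_deleted_h by auto
  next
    case (10 r h q) then show ?case using deleted_worse not_deleted_h by auto
  next
    case (11 h' q) then show ?case
      using above_lower_rejected assms(2) by (auto simp: card_res_of_insert mem_res_of split: if_splits)
  next
    case (12 r h h') then show ?case using better_deleted target_better_deleted by auto
  next
    case (13 r' h'' h')
    then have "lower I h' \<le> card (res_of (assigned s) h')"
      using tie_lower target_tie_lower by auto
    then show ?case by (simp add: card_res_of_insert le_SucI)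
  qed
qed

text \<open>Covers rules (2) and (4), which correspond to the two alternatives for
  \<open>D\<close>.\<close>

lemma dp_invariant_swap:
  assumes w: "w \<in> insert r (res_of (assigned s) h)"
    and lower: "lower I h \<le> card (res_of (assigned s) h)"
    and del: "D = deleted s \<and> (w, h) \<notin> rejected s \<or>
      D = insert (w, h) (deleted s) \<and> card (res_of (assigned s) h) = upper I h \<and>
      (\<forall>q\<in>insert r (res_of (assigned s) h). (q, h) \<in> rejected s \<and> (q, w) \<in> hosp_pref I h)"
  shows "dp_invariant I (s\<lparr>assigned := insert (r, h) (assigned s) - {(w, h)},
           proposed := insert (r, h) (proposed s),
           rejected := insert (w, h) (rejected s), deleted := D\<rparr>)"
proof -
  have w_proposed: "(w, h) \<in> insert (r, h) (proposed s)"
    using w proposed_eq by (auto simp: mem_res_of)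
  \<comment> \<open>Under rule (2), if \<open>h\<close> has been deleted from some list or exceeds
    its lower quota, all its current residents have been rejected before. Only the newcomer can then
    be the unrejected \<open>w\<close>, and the assignment does not change.\<close>
  have unrejected: "w = r" if "(w, h) \<notin> rejected s" "(q, h) \<in> deleted s" for q
    using that w deleted_all_rejected by (auto simp: mem_res_of)
  have unrejected': "w = r" if "(w, h) \<notin> rejected s" "lower I h < card (res_of (assigned s) h)"
    using that w above_lower_rejected by (auto simp: mem_res_of)
  show ?thesis
  proof (unfold_locales, goal_cases)
    case 1 show ?case using proposed_subset r h by auto
  next
    case 2 show ?case using proposed_eq w_proposed by auto
  next
    case (3 r h) then show ?case using deleted_rejected del by auto
  next
    case (4 r h) then show ?case using assigned_not_deleted not_deleted del by auto
  next
    case (5 r h h') then show ?case using assigned_unique unassigned by auto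
  next
    case (6 h) then show ?case using card_le_upper by (simp add: card_res_of_swap[OF w])
  next
    case (7 r h) then show ?case using rejected_lower lower by (auto simp: card_res_of_swap[OF w])
  next
    case (8 r h) then show ?case using deleted_full del by (auto simp: card_res_of_swap[OF w])
  next
    case (9 r' h' q)
    show ?case
    proof (cases "h' = h")
      case True
      then show ?thesis using 9 del w deleted_all_rejected unrejected by (auto simp: mem_res_of)
    next
      case False
      then show ?thesis using 9 del deleted_all_rejected by auto
    qed
  next
    case (10 r' h' q)
    show ?case
    proof (cases "h' = h \<and> q = r \<and> (r', h) \<in> deleted s")
      case True
      \<comment> \<open>The newcomer stays, so this is rule (4) and \<open>r\<close> is at least as
        good as the expelled \<open>w\<close>. The older deletion of \<open>r'\<close> makes
        \<open>w\<close> at least as good as \<open>r'\<close>; transitivity gives the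
        claim.\<close>
      then have "w \<noteq> r" "w \<in> res_of (assigned s) h" using 10 w by auto
      moreover from this have "(r, w) \<in> hosp_pref I h"
        using del unrejected True by auto
      ultimately show ?thesis
        using True deleted_worse[of r' h w] total_preorder_on_trans[OF hosp_pref[OF h]]
        by (auto simp: mem_res_of)
    next
      case False
      then show ?thesis using 10 del deleted_worse by (auto simp: mem_res_of)
    qed
  next
    case (11 h' q)
    show ?case
    proof (cases "h' = h")
      case True
      then show ?thesis using 11 del w above_lower_rejected unrejected'
        by (auto simp: card_res_of_swap[OF w] mem_res_of)
    next
      case False
      then show ?thesis using 11 above_lower_rejected by (auto simp: card_res_of_swap[OF w])
    qed
  next
    case (12 r h h') then show ?case using better_deleted target_better_deleted del by auto
  next
    case (13 r' h'' h')
    then show ?case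
      using tie_lower target_tie_lower by (auto simp: card_res_of_swap[OF w])
  qed
qed

text \<open>Each rule enlarges exactly one summand of \<open>progress\<close>: rules (1) and (3) add
  an assigned pair, rule (2) a first rejection, and rule (4) a deletion, its rejection being already
  recorded.\<close>

lemma dp_propose_progress:
  "dp_invariant I (dp_propose I r h s) \<and> progress s < progress (dp_propose I r h s)"
proof -
  let ?M = "assigned s"
  let ?A = "insert r (res_of ?M h)"
  let ?F = "{q \<in> ?A. (q, h) \<notin> rejected s}"
  have fin: "finite ?M" "finite (rejected s)" "finite (deleted s)"
    using assigned_subset rejected_subset deleted_subset by (auto intro: finite_assignment)
  have card_swap: "card (insert (r, h) ?M - {(w, h)}) = card ?M" if "w \<in> ?A" for w
    using that fin unassigned by (auto simp: mem_res_of card_Diff_singleton)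
  consider (below) "card (res_of ?M h) < lower I h"
    | (reject) "\<not> card (res_of ?M h) < lower I h" "?F \<noteq> {}"
    | (fill) "\<not> card (res_of ?M h) < lower I h" "?F = {}" "card (res_of ?M h) < upper I h"
    | (delete) "\<not> card (res_of ?M h) < lower I h" "?F = {}" "\<not> card (res_of ?M h) < upper I h"
    by blast
  then show ?thesis
  proof cases
    case below
    then have "dp_propose I r h s =
        s\<lparr>assigned := insert (r, h) ?M, proposed := insert (r, h) (proposed s)\<rparr>"
      by (simp add: dp_propose_def Let_def)
    then show ?thesis
      using dp_invariant_accept below lower_le_upper[OF h] fin unassigned
      by (simp add: progress_def)
  next
    case reject
    define w where "w = Max ?F"
    have w: "w \<in> ?F"
      unfolding w_def by (rule Max_in) (use reject in auto)
    have eq: "dp_propose I r h s =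
        s\<lparr>assigned := insert (r, h) ?M - {(w, h)}, proposed := insert (r, h) (proposed s),
          rejected := insert (w, h) (rejected s), deleted := deleted s\<rparr>"
      using reject unfolding dp_propose_def Let_def w_def[symmetric] by simp
    have "dp_invariant I (dp_propose I r h s)"
      unfolding eq by (rule dp_invariant_swap) (use w reject in auto)
    moreover have "progress s < progress (dp_propose I r h s)"
      unfolding eq using w fin card_swap[of w] by (simp add: progress_def)
    ultimately show ?thesis ..
  next
    case fill
    then have "dp_propose I r h s =
        s\<lparr>assigned := insert (r, h) ?M, proposed := insert (r, h) (proposed s)\<rparr>"
      unfolding dp_propose_def Let_def by simp
    then show ?thesis
      using dp_invariant_accept fill fin unassigned
      by (auto simp: progress_def)
  next
    case delete
    define w where "w = worst I h ?A"
    let ?W = "{q \<in> ?A. \<forall>q'\<in>?A. (q', q) \<in> hosp_pref I h}"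
    have "\<exists>q\<in>?A. \<forall>q'\<in>?A. (q', q) \<in> hosp_pref I h"
      by (rule total_preorder_on_worst[OF hosp_pref[OF h]])
        (use r assigned_subset in \<open>auto simp: mem_res_of\<close>)
    then have "?W \<noteq> {}" by blast
    moreover have "finite ?W" by simp
    ultimately have w: "w \<in> ?W"
      unfolding w_def worst_def by (rule Max_in[rotated])
    have eq: "dp_propose I r h s =
        s\<lparr>assigned := insert (r, h) ?M - {(w, h)}, proposed := insert (r, h) (proposed s),
          rejected := insert (w, h) (rejected s), deleted := insert (w, h) (deleted s)\<rparr>"
      using delete unfolding dp_propose_def Let_def w_def[symmetric] by simp
    have rejected: "(w, h) \<in> rejected s" using w delete by blast
    have full: "card (res_of ?M h) = upper I h"
      using delete card_le_upper[OF h] by simp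
    have "dp_invariant I (dp_propose I r h s)"
      unfolding eq by (rule dp_invariant_swap) (use w delete full in auto)
    moreover have "(w, h) \<notin> deleted s"
      using w not_deleted assigned_not_deleted by (auto simp: mem_res_of)
    then have "progress s < progress (dp_propose I r h s)"
      unfolding eq using w fin card_swap[of w] rejected by (simp add: progress_def insert_absorb)
    ultimately show ?thesis ..
  qed
qed

end

section \<open>The loop: choice of the target, termination, stability\<close>

context dp_invariant
begin

lemma dp_proposal_target:
  assumes r: "r \<in> unmatched I s"
  shows "dp_proposal I s r (target I s r)"
proof -
  let ?T = "top_tie I s r"
  let ?N = "{h \<in> ?T. (r, h) \<notin> proposed s}"
  define K where "K = (if ?N \<noteq> {} then ?N else ?T)"
  have rR: "r \<in> residents I" and un: "(r, h') \<notin> assigned s" for h'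
    using r by (auto simp: unmatched_def hosp_of_def)
  note pref = res_pref[OF rR]
  \<comment> \<open>Some hospital is not full, and such a hospital is deleted from no list.\<close>
  have "current_list I s r \<noteq> {}"
    using exists_not_full[OF assigned_subset assigned_unique] deleted_full
    by (force simp: current_list_def)
  then have "\<exists>a\<in>current_list I s r. \<forall>b\<in>current_list I s r. (a, b) \<in> res_pref I r"
    by (intro total_preorder_on_best[OF pref]) (auto simp: current_list_def)
  then have "K \<noteq> {}" by (auto simp: K_def top_tie_def)
  moreover have finK: "finite K"
    by (rule finite_subset[OF _ finite_hospitals]) (auto simp: K_def top_tie_def current_list_def)
  ultimately obtain h0 where "h0 \<in> K" "\<forall>h'\<in>K. lower I h0 \<le> lower I h'"
    using arg_min_if_finite(1) arg_min_least by metis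
  then have "{h \<in> K. \<forall>h'\<in>K. lower I h \<le> lower I h'} \<noteq> {}" by blast
  then have "min_lower I K \<in> {h \<in> K. \<forall>h'\<in>K. lower I h \<le> lower I h'}"
    unfolding min_lower_def using finK by (intro Max_in Min_in) auto
  moreover define h where "h = target I s r"
  moreover have "target I s r = min_lower I K"
    unfolding target_def Let_def K_def ..
  ultimately have hK: "h \<in> K" and h_min: "\<And>h'. h' \<in> K \<Longrightarrow> lower I h \<le> lower I h'"
    by auto
  have hT: "h \<in> ?T" using hK by (auto simp: K_def split: if_splits)
  then have hH: "h \<in> hospitals I" and hnd: "(r, h) \<notin> deleted s"
    and htop: "\<And>h'. h' \<in> hospitals I \<Longrightarrow> (r, h') \<notin> deleted s \<Longrightarrow> (h, h') \<in> res_pref I r"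
    by (auto simp: top_tie_def current_list_def)
  have "dp_proposal I s r h"
  proof (unfold_locales, goal_cases)
    case (6 h')
    then have tie: "h' \<in> ?T" if "(r, h') \<notin> deleted s"
      using that htop total_preorder_on_trans[OF pref] by (auto simp: top_tie_def current_list_def)
    \<comment> \<open>Were \<open>h'\<close> an unproposed hospital of the tie, the target would be
      chosen from \<open>?N\<close>. Then \<open>h\<close> would be unproposed, hence unrejected,
      and of minimal lower quota there, against the premise.\<close>
    have "h' \<notin> ?N"
    proof
      assume "h' \<in> ?N"
      then have "h' \<in> K" "h \<in> ?N" using hK by (auto simp: K_def split: if_splits)
      then show False using 6 h_min[of h'] proposed_eq by auto
    qed
    \<comment> \<open>A proposal of a currently unmatched resident has led to a rejection.\<close>
    then have "(r, h') \<in> rejected s"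
      using tie deleted_rejected proposed_eq un by blast
    then show ?case by (rule rejected_lower)
  qed (use rR hH un hnd htop in \<open>auto simp: strictly_prefers_def\<close>)
  then show ?thesis unfolding h_def .
qed

lemma dp_step_progress:
  assumes "unmatched I s \<noteq> {}"
  shows "dp_invariant I (dp_step I s) \<and> progress s < progress (dp_step I s)"
proof -
  have "finite (unmatched I s)" by (simp add: unmatched_def)
  then have "Min (unmatched I s) \<in> unmatched I s" using assms by (rule Min_in)
  then interpret dp_proposal I s "Min (unmatched I s)" "target I s (Min (unmatched I s))"
    by (rule dp_proposal_target)
  show ?thesis unfolding dp_step_def Let_def by (rule dp_propose_progress)
qed

lemma progress_le: "progress s \<le> 3 * (num_res I * num_hosp I)"
proof -
  have "card X \<le> num_res I * num_hosp I" if "X \<subseteq> residents I \<times> hospitals I" for X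
    using card_mono[OF _ that]
    by (simp add: card_cartesian_product) (simp add: residents_def hospitals_def)
  from this[OF assigned_subset] this[OF rejected_subset] this[OF deleted_subset]
  show ?thesis by (simp add: progress_def)
qed

text \<open>A hospital that \<open>r\<close> prefers to its own has been deleted from its list,
  hence is full and holds nobody worse than \<open>r\<close>.\<close>

lemma stable_matching_assigned:
  assumes "unmatched I s = {}"
  shows "stable_matching I (assigned s)"
proof -
  have "finite (hosp_of (assigned s) r)" for r
    by (rule finite_subset[OF _ finite_hospitals]) (use assigned_subset in \<open>auto simp: hosp_of_def\<close>)
  then have "card (hosp_of (assigned s) r) \<le> 1" for r
    using assigned_unique by (auto simp: card_le_Suc0_iff_eq mem_hosp_of)
  then have "matching I (assigned s)"
    using assigned_subset card_le_upper by (auto simp: matching_def)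
  moreover have "\<not> blocks I (assigned s) r h"
    if "r \<in> residents I" "h \<in> hospitals I" for r h
  proof
    assume b: "blocks I (assigned s) r h"
    have "hosp_of (assigned s) r \<noteq> {}" using assms that by (auto simp: unmatched_def)
    then have "(r, h) \<in> deleted s"
      using b better_deleted that by (auto simp: blocks_def mem_hosp_of)
    then show False
      using b deleted_full deleted_worse
      by (fastforce simp: blocks_def mem_res_of strictly_prefers_def)
  qed
  ultimately show ?thesis by (auto simp: stable_matching_def)
qed

end

lemma (in hrt) double_proposal_terminates:
  "\<exists>s. dp_invariant I s \<and> unmatched I s = {} \<and> double_proposal I = Some (assigned s)"
proof -
  let ?b = "\<lambda>s. unmatched I s \<noteq> {}"
  have "\<exists>t. while_option ?b (dp_step I) dp_init = Some t"
  proof (rule measure_while_option_Some[where P = "dp_invariant I"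
        and f = "\<lambda>s. 3 * (num_res I * num_hosp I) - progress s"])
    fix s assume s: "dp_invariant I s" "?b s"
    \<comment> \<open>With truncated subtraction the decrease needs \<open>progress_le\<close> for
      the new state, so that the old value lies strictly below the bound.\<close>
    show "dp_invariant I (dp_step I s) \<and>
        3 * (num_res I * num_hosp I) - progress (dp_step I s) <
        3 * (num_res I * num_hosp I) - progress s"
      using dp_invariant.dp_step_progress[OF s] dp_invariant.progress_le[of I "dp_step I s"] by auto
  qed (rule dp_invariant_init)
  then obtain t where t: "while_option ?b (dp_step I) dp_init = Some t" ..
  have "dp_invariant I t"
    by (rule while_option_rule[OF _ t]) (use dp_invariant.dp_step_progress dp_invariant_init in auto)
  then show ?thesis using t while_option_stop[OF t] by (auto simp: double_proposal_def)
qed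


section \<open>Optimality under a master list\<close>

context hrt
begin

lemma stable_matching_unique:
  assumes "stable_matching I M" "(r, h) \<in> M" "(r, h') \<in> M"
  shows "h = h'"
proof -
  have M: "M \<subseteq> residents I \<times> hospitals I" and c: "card (hosp_of M r) \<le> 1"
    using assms by (auto simp: stable_matching_def matching_def)
  have "finite (hosp_of M r)"
    by (rule finite_subset[OF _ finite_hospitals]) (use M in \<open>auto simp: hosp_of_def\<close>)
  then show ?thesis using c assms by (auto simp: card_le_Suc0_iff_eq mem_hosp_of)
qed

text \<open>Some hospital has room, so an unmatched resident would block with it; thus everybody is
  matched.\<close>

lemma stable_matching_card:
  assumes M: "stable_matching I M"
  shows "(\<Sum>h\<in>hospitals I. card (res_of M h)) = card (residents I)"
proof -
  have sub: "M \<subseteq> residents I \<times> hospitals I"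
    using M by (auto simp: stable_matching_def matching_def)
  note unique = stable_matching_unique[OF M]
  obtain h where h: "h \<in> hospitals I" "card (res_of M h) < upper I h"
    using exists_not_full[OF sub] unique by blast
  then have "{r \<in> residents I. hosp_of M r \<noteq> {}} = residents I"
    using M by (auto simp: stable_matching_def blocks_def)
  then show ?thesis
    using card_functional_assignment[OF finite_residents sub] unique
      card_assignment_res_of[OF finite_hospitals finite_residents sub] by simp
qed

text \<open>Under the master list, any resident at \<open>h'\<close> would block with
  \<open>h\<close> if \<open>h\<close> had room.\<close>

lemma stable_matching_better_full:
  assumes M: "stable_matching I M" and master: "\<And>r. r \<in> residents I \<Longrightarrow> res_pref I r = P"
    and h: "h \<in> hospitals I" "strictly_prefers P h h'" and pos: "0 < card (res_of M h')"
  shows "card (res_of M h) = upper I h"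
proof -
  have "res_of M h' \<noteq> {}" using pos by auto
  then obtain r where r: "(r, h') \<in> M" by (auto simp: res_of_def)
  have matching: "matching I M" and no_block: "\<And>q. q \<in> residents I \<Longrightarrow> \<not> blocks I M q h"
    using M h by (auto simp: stable_matching_def)
  have r_res: "r \<in> residents I" and "card (res_of M h) \<le> upper I h"
    using matching r h by (auto simp: matching_def)
  moreover have "\<not> card (res_of M h) < upper I h"
  proof
    assume "card (res_of M h) < upper I h"
    moreover have "hosp_of M r = {h'}"
      using r by (auto simp: hosp_of_def dest: stable_matching_unique[OF M r])
    ultimately have "blocks I M r h"
      using h master[OF r_res] by (simp add: blocks_def)
    then show False using no_block[OF r_res] by simp
  qed
  ultimately show ?thesis by simp
qed

lemma hosp_score_nonneg: "0 \<le> hosp_score I M h"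
  by (simp add: hosp_score_def)

text \<open>Makes the ratio meaningful: some hospital is nonempty and contributes a positive
  score.\<close>

lemma score_pos:
  assumes "stable_matching I M"
  shows "0 < score I M"
proof -
  have "(\<Sum>h\<in>hospitals I. card (res_of M h)) \<noteq> 0"
    using stable_matching_card[OF assms] residents_nonempty by simp
  then obtain h where "h \<in> hospitals I" "card (res_of M h) \<noteq> 0"
    by (meson sum.neutral)
  then show ?thesis
    unfolding score_def
    by (intro sum_pos2[of _ h]) (auto simp: hosp_score_nonneg, simp add: hosp_score_def)
qed

text \<open>
  Let \<open>c\<close> be a least preferred hospital that is nonempty in \<open>M\<close>. Stability forces every stable
  matching to fill all hospitals above \<open>c\<close> and to leave all hospitals below \<open>c\<close> empty. If \<open>M\<close>
  misses a lower quota in the tie of \<open>c\<close>, let \<open>L\<close> be the least one missed: compared with \<open>M\<close>,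
  each resident added to a hospital of the tie gains at most \<open>1 / L\<close> and each resident removed
  costs at least \<open>1 / L\<close>, and there are as many additions as removals.
\<close>

lemma score_le_greedy:
  assumes M: "stable_matching I M" and N: "stable_matching I N"
    and master: "\<And>r. r \<in> residents I \<Longrightarrow> res_pref I r = P"
    and greedy: "\<And>h h'. h \<in> hospitals I \<Longrightarrow> h' \<in> hospitals I \<Longrightarrow>
      (h, h') \<in> P \<Longrightarrow> (h', h) \<in> P \<Longrightarrow> lower I h' < lower I h \<Longrightarrow> 0 < card (res_of M h) \<Longrightarrow>
      lower I h' \<le> card (res_of M h')"
    and greedy': "\<And>h h'. h \<in> hospitals I \<Longrightarrow> h' \<in> hospitals I \<Longrightarrow>
      (h, h') \<in> P \<Longrightarrow> (h', h) \<in> P \<Longrightarrow> lower I h < card (res_of M h) \<Longrightarrow>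
      lower I h' \<le> card (res_of M h')"
  shows "score I N \<le> score I M"
proof -
  define x where "x h = card (res_of N h)" for h
  define y where "y h = card (res_of M h)" for h
  have P: "total_preorder_on (hospitals I) P"
  proof -
    obtain r where "r \<in> residents I" using residents_nonempty by blast
    then show ?thesis using res_pref[of r] master[of r] by simp
  qed
  note P_trans = total_preorder_on_trans[OF P]
  have sum_eq: "sum x (hospitals I) = sum y (hospitals I)"
    using stable_matching_card M N by (simp add: x_def y_def)
  have le_upper: "x h \<le> upper I h" "y h \<le> upper I h" if "h \<in> hospitals I" for h
    using that M N by (auto simp: x_def y_def stable_matching_def matching_def)
  have full: "x h = upper I h" if "h \<in> hospitals I" "strictly_prefers P h h'" "0 < x h'" for h h'
    using stable_matching_better_full[OF N master that(1,2)] that(3) by (simp add: x_def)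
  have full': "y h = upper I h" if "h \<in> hospitals I" "strictly_prefers P h h'" "0 < y h'" for h h'
    using stable_matching_better_full[OF M master that(1,2)] that(3) by (simp add: y_def)
  have "sum y (hospitals I) \<noteq> 0"
    using stable_matching_card[OF M] residents_nonempty by (simp add: y_def)
  then obtain g where "g \<in> hospitals I" "y g \<noteq> 0" by (meson sum.neutral)
  then have "{h \<in> hospitals I. 0 < y h} \<noteq> {}" by auto
  then have "\<exists>c\<in>{h \<in> hospitals I. 0 < y h}. \<forall>h\<in>{h \<in> hospitals I. 0 < y h}. (h, c) \<in> P"
    by (intro total_preorder_on_worst[OF P]) auto
  then obtain c where c: "c \<in> hospitals I" "0 < y c"
    and c_worst: "\<And>h. h \<in> hospitals I \<Longrightarrow> 0 < y h \<Longrightarrow> (h, c) \<in> P" by blast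
  \<comment> \<open>If the loads differ at \<open>h\<close>, then \<open>h\<close> is not full in
    \<open>N\<close>, so \<open>N\<close> is empty from \<open>c\<close> downwards. As
    \<open>M\<close> fills everything above \<open>c\<close>, \<open>x\<close> is nowhere larger
    than \<open>y\<close> and is smaller at \<open>c\<close>, against equal totals.\<close>
  have x_above: "x h = y h" if h: "h \<in> hospitals I" "strictly_prefers P h c" for h
  proof (rule ccontr)
    assume "x h \<noteq> y h"
    then have not_full: "x h \<noteq> upper I h" using full'[OF h c(2)] by simp
    have empty: "x g = 0" if "(c, g) \<in> P" for g
    proof -
      have "strictly_prefers P h g" using h(2) that P_trans by (auto simp: strictly_prefers_def)
      then show ?thesis using full[OF h(1)] not_full by blast
    qed
    have "x g \<le> y g" if g: "g \<in> hospitals I" for g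
    proof (cases "(c, g) \<in> P")
      case True
      then show ?thesis using empty by simp
    next
      case False
      then have "strictly_prefers P g c"
        using total_preorder_on_total[OF P g c(1)] by (auto simp: strictly_prefers_def)
      then show ?thesis using full'[OF g _ c(2)] le_upper(1)[OF g] by simp
    qed
    moreover have "x c < y c" using empty total_preorder_on_refl[OF P c(1)] c(2) by simp
    ultimately have "sum x (hospitals I) < sum y (hospitals I)"
      using c(1) by (intro sum_strict_mono_ex1) auto
    then show False using sum_eq by simp
  qed
  \<comment> \<open>\<open>M\<close> is empty below \<open>c\<close>. A resident of \<open>N\<close>
    at \<open>h\<close> forces \<open>N\<close> to fill everything above \<open>h\<close>, in
    particular all hospitals that \<open>M\<close> uses, which makes the total of \<open>x\<close>
    too large.\<close>
  have x_below: "x h = y h" if h: "h \<in> hospitals I" "strictly_prefers P c h" for h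
  proof (rule ccontr)
    assume ne: "x h \<noteq> y h"
    have empty: "y g = 0" if "g \<in> hospitals I" "(g, c) \<notin> P" for g
      using c_worst that by auto
    then have "y h = 0" using h by (auto simp: strictly_prefers_def)
    then have pos: "0 < x h" using ne by simp
    have "y g \<le> x g" if g: "g \<in> hospitals I" for g
    proof (cases "(g, c) \<in> P")
      case True
      then have "strictly_prefers P g h" using h(2) P_trans by (auto simp: strictly_prefers_def)
      then show ?thesis using full[OF g _ pos] le_upper(2)[OF g] by simp
    next
      case False
      then show ?thesis using empty g by simp
    qed
    then have "sum y (hospitals I) < sum x (hospitals I)"
      using h(1) pos \<open>y h = 0\<close> by (intro sum_strict_mono_ex1) (auto intro!: bexI[of _ h])
    then show False using sum_eq by simp
  qed
  have tie_or_eq: "x h = y h \<or> (h, c) \<in> P \<and> (c, h) \<in> P" if "h \<in> hospitals I" for h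
    using total_preorder_on_total[OF P that c(1)] x_above x_below that
    by (auto simp: strictly_prefers_def)
  define D where "D = {h \<in> hospitals I. (h, c) \<in> P \<and> (c, h) \<in> P \<and> y h < lower I h}"
  \<comment> \<open>\<open>lam\<close> acts as a Lagrange multiplier for the equal totals: its terms
    cancel on summation. It is 0 if \<open>D\<close> is empty, and otherwise the reciprocal of the
    least lower quota missed.\<close>
  have "\<exists>lam::real. \<forall>h\<in>hospitals I.
      hosp_score I N h \<le> hosp_score I M h + lam * (real (x h) - real (y h))"
  proof (cases "D = {}")
    case True
    have "hosp_score I N h \<le> hosp_score I M h" if h: "h \<in> hospitals I" for h
    proof (cases "x h = y h")
      case True
      then show ?thesis by (simp add: hosp_score_def x_def y_def)
    next
      case False
      then have "h \<notin> D \<and> (h, c) \<in> P \<and> (c, h) \<in> P" using tie_or_eq[OF h] \<open>D = {}\<close> by simp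
      then have "lower I h \<le> y h" using h by (auto simp: D_def)
      then show ?thesis by (auto simp: hosp_score_def y_def)
    qed
    then show ?thesis by (intro exI[of _ 0]) simp
  next
    case False
    have "finite D" by (simp add: D_def)
    then obtain d where d: "d \<in> D" and d_min: "\<And>h. h \<in> D \<Longrightarrow> lower I d \<le> lower I h"
      using False arg_min_if_finite(1) arg_min_least by metis
    have "hosp_score I N h \<le>
        hosp_score I M h + 1 / real (lower I d) * (real (x h) - real (y h))"
      if h: "h \<in> hospitals I" for h
    proof (cases "x h = y h")
      case True
      then show ?thesis by (simp add: hosp_score_def x_def y_def)
    next
      case False
      then have tie_c: "(h, c) \<in> P" "(c, h) \<in> P" using tie_or_eq[OF h] by auto
      have dH: "d \<in> hospitals I" and d_c: "(d, c) \<in> P" "(c, d) \<in> P"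
        and deficient: "y d < lower I d"
        using d by (auto simp: D_def)
      have tie: "(h, d) \<in> P" "(d, h) \<in> P"
        using P_trans[OF tie_c(1) d_c(2)] P_trans[OF d_c(1) tie_c(2)] .
      \<comment> \<open>By the contrapositive of \<open>greedy'\<close>, no hospital of the tie
        exceeds its lower quota while \<open>d\<close> misses its own.\<close>
      have y_le: "y h \<le> lower I h"
        using greedy'[OF h dH tie] deficient unfolding y_def by linarith
      show ?thesis
      proof (cases "lower I h = 0")
        case True
        then show ?thesis using y_le by (simp add: hosp_score_def)
      next
        case False
        \<comment> \<open>Minimality of \<open>d\<close> and the contrapositive of
          \<open>greedy\<close> give the two slope conditions of
          \<open>score_diff_le\<close>.\<close>
        have "lower I d \<le> lower I h" if "y h < lower I h"
          using that h tie_c by (intro d_min) (simp add: D_def)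
        moreover have "lower I h \<le> lower I d" if "0 < y h"
          using greedy[OF h dH tie] deficient that unfolding y_def by linarith
        ultimately have "min 1 (real (x h) / real (lower I h)) \<le>
            min 1 (real (y h) / real (lower I h)) + (real (x h) - real (y h)) / real (lower I d)"
          using False deficient y_le by (intro score_diff_le) auto
        then show ?thesis using False by (simp add: hosp_score_def x_def y_def)
      qed
    qed
    then show ?thesis by blast
  qed
  then obtain lam :: real where lam: "\<And>h. h \<in> hospitals I \<Longrightarrow>
      hosp_score I N h \<le> hosp_score I M h + lam * (real (x h) - real (y h))" by blast
  have "score I N \<le>
      (\<Sum>h\<in>hospitals I. hosp_score I M h + lam * (real (x h) - real (y h)))"
    unfolding score_def by (intro sum_mono lam)
  also have "\<dots> = score I M + lam * (real (sum x (hospitals I)) - real (sum y (hospitals I)))"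
    by (simp add: score_def sum.distrib sum_distrib_left[symmetric] sum_subtractf)
  finally show ?thesis using sum_eq by simp
qed

section \<open>Optimality of the output\<close>

lemma double_proposal_optimal:
  assumes master: "\<And>r. r \<in> residents I \<Longrightarrow> res_pref I r = P"
  shows "\<exists>M. double_proposal I = Some M \<and> stable_matching I M \<and>
    (\<forall>M'. stable_matching I M' \<longrightarrow> score I M' \<le> score I M)"
proof -
  obtain s where s: "dp_invariant I s" "unmatched I s = {}" "double_proposal I = Some (assigned s)"
    using double_proposal_terminates by blast
  interpret dp_invariant I s by (rule s(1))
  have stable: "stable_matching I (assigned s)" using s(2) by (rule stable_matching_assigned)
  have "score I M' \<le> score I (assigned s)" if "stable_matching I M'" for M'
  proof (rule score_le_greedy[OF stable that master])
    fix h h'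
    assume *: "h' \<in> hospitals I" "(h, h') \<in> P" "(h', h) \<in> P"
    have tie: "lower I h' \<le> card (res_of (assigned s) h')"
      if "(r, h) \<in> assigned s" "lower I h' < lower I h \<or> (r, h) \<in> rejected s" for r
    proof -
      have "r \<in> residents I" using that(1) assigned_subset by auto
      then show ?thesis using tie_lower[OF that(1) *(1) _ _ that(2)] *(2,3) master by simp
    qed
    have ex: "\<exists>r. (r, h) \<in> assigned s" if "0 < card (res_of (assigned s) h)"
    proof -
      have "res_of (assigned s) h \<noteq> {}" using that by auto
      then show ?thesis by (auto simp: res_of_def)
    qed
    show "lower I h' \<le> card (res_of (assigned s) h')"
      if "lower I h' < lower I h" "0 < card (res_of (assigned s) h)"
      using tie ex that by blast
    \<comment> \<open>Above the lower quota every resident of \<open>h\<close> has been rejected by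
      it, so the second alternative of \<open>tie_lower\<close> applies.\<close>
    show "lower I h' \<le> card (res_of (assigned s) h')"
      if "lower I h < card (res_of (assigned s) h)"
    proof -
      have "0 < card (res_of (assigned s) h)" using that by simp
      then obtain r where "(r, h) \<in> assigned s" using ex by blast
      then show ?thesis using tie above_lower_rejected[OF that] by blast
    qed
  qed
  then show ?thesis using s(3) stable by blast
qed

lemma ALG_pos_OPT_eq:
  assumes "double_proposal I = Some M" "stable_matching I M"
    and "\<forall>M'. stable_matching I M' \<longrightarrow> score I M' \<le> score I M"
  shows "0 < ALG I" "OPT I = ALG I"
proof -
  have ALG: "ALG I = score I M" using assms(1) by (simp add: ALG_def)
  show "0 < ALG I" using score_pos[OF assms(2)] ALG by simp
  have "finite {M. stable_matching I M}"
    by (rule finite_subset[of _ "Pow (residents I \<times> hospitals I)"])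
      (auto simp: stable_matching_def matching_def)
  then show "OPT I = ALG I"
    unfolding OPT_def ALG by (intro Max_eqI) (use assms in auto)
qed

end

text \<open>Needed for the value 1 to be attained by some ratio.\<close>

lemma R_ML_nonempty: "R_ML \<noteq> {}"
proof -
  \<comment> \<open>One resident and two hospitals with one place each satisfy the strict quota
    inequality 1 < 2.\<close>
  define I where "I = \<lparr>num_res = 1, num_hosp = 2, res_pref = (\<lambda>_. {1..2} \<times> {1..2}),
    hosp_pref = (\<lambda>_. {1..1} \<times> {1..1}), lower = (\<lambda>_. 0), upper = (\<lambda>_. 1)\<rparr>"
  have "I \<in> R_ML"
    by (auto simp: I_def R_ML_def hrt_mslq_def residents_def hospitals_def total_preorder_on_def
        preorder_on_def refl_on_def total_on_def intro!: transI)
  then show ?thesis by blast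
qed

theorem theorem33:
  shows "(\<forall>I\<in>R_ML. ALG I > 0) \<and>
    is_maximum 1 {OPT I / ALG I | I. I \<in> R_ML} \<and>
    (\<forall>I\<in>R_ML. \<exists>M. double_proposal I = Some M \<and> stable_matching I M \<and>
       (\<forall>M'. stable_matching I M' \<longrightarrow> score I M' \<le> score I M))"
proof -
  have optimal: "\<exists>M. double_proposal I = Some M \<and> stable_matching I M \<and>
       (\<forall>M'. stable_matching I M' \<longrightarrow> score I M' \<le> score I M)" if "I \<in> R_ML" for I
  proof -
    interpret hrt I using that by unfold_locales (simp add: R_ML_def)
    obtain r0 where "r0 \<in> residents I" using residents_nonempty by blast
    then have "res_pref I r = res_pref I r0" if "r \<in> residents I" for r
      using that \<open>I \<in> R_ML\<close> unfolding R_ML_def by blast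
    then show ?thesis by (rule double_proposal_optimal)
  qed
  have eq: "0 < ALG I \<and> OPT I = ALG I" if "I \<in> R_ML" for I
  proof -
    interpret hrt I using that by unfold_locales (simp add: R_ML_def)
    show ?thesis using optimal[OF that] ALG_pos_OPT_eq by blast
  qed
  have "OPT I / ALG I = 1" if "I \<in> R_ML" for I using eq[OF that] by simp
  then have "{OPT I / ALG I | I. I \<in> R_ML} = {1}"
    using R_ML_nonempty by (force simp del: divide_eq_1_iff)
  then show ?thesis using eq optimal by (simp add: is_maximum_def)
qed

end
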